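(* Let the standing assumption stated in the context be satisfied. Let $\bar\xi\in Y$ be the unique solution of $\nabla\Phi(\bar\xi)=0$. Let $(\xi_k)$ be a sequence of iterates of the globalized inexact semismooth Newton method described in the context. Then $\xi_k\to\bar\xi$ q-superlinearly, i.e. $\xi_k\to\bar\xi$ in $Y$ and $\|\xi_{k+1}-\bar\xi\|_Y=o(\|\xi_k-\bar\xi\|_Y)$ as $k\to\infty$.
   Context: Setting. $U,Y$ are real Hilbert spaces, $S:U\to Y$ is a bounded linear operator with Hilbert space adjoint $S^*$, $z\in Y$, $\alpha>0$, and $g:U\to\mathbb R\cup\{+\infty\}$ is proper, convex, lower semicontinuous with $g(0)<+\infty$. For a proper convex lower semicontinuous function $h$ on a Hilbert space $X$, $\operatorname{env}_h(\zeta):=\min_{x\in X}\frac12\|x-\zeta\|_X^2+h(x)$ and $\operatorname{prox}_h(\zeta)$ is the unique minimizer. Define $\Psi,\Phi:Y\to\mathbb R$ by $$\Psi(\xi)=\frac1{2\alpha}\|S^*\xi\|_U^2-\alpha\operatorname{env}_{g/\alpha}(S^*\xi/\alpha),\qquad \Phi(\xi)=\frac12\|\xi-z\|_Y^2-\frac12\|z\|_Y^2+\Psi(\xi).$$ Both are continuously differentiable, with gradients $\nabla\Psi(\xi)=S\operatorname{prox}_{g/\alpha}(S^*\xi/\alpha)$ and $\nabla\Phi(\xi)=\xi-z+S\operatorname{prox}_{g/\alpha}(S^*\xi/\alpha)$. The equation $\nabla\Phi(\xi)=0$ has a unique solution. Second-order semismoothness. Let $\mathcal L(Y,Y)$ be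 the space of bounded linear operators on $Y$. A continuously differentiable $T:Y\to\mathbb R$ is second-order semismooth with respect to a set-valued map $\partial^2T:Y\rightrightarrows\mathcal L(Y,Y)$ with non-empty images if for every $y\in Y$, as $\|h\|_Y\to0$, $\sup_{M\in\partial^2T(y+h)}|T(y+h)-T(y)-T'(y)h-\frac12\langle Mh,h\rangle|=o(\|h\|_Y^2)$ and $\sup_{M\in\partial^2T(y+h)}\|\nabla T(y+h)-\nabla T(y)-Mh\|_Y=o(\|h\|_Y)$. Standing assumption. Let $\mathcal B:=\{M\in\mathcal L(Y,Y): M=M^*,\ \langle My,y\rangle\ge0\ \forall y\in Y\}$. There is a set-valued map $\partial^2\Psi:Y\rightrightarrows\mathcal B$ such that $\Psi$ is second-order semismooth with respect to $\partial^2\Psi$, and there is $c>0$ with $\|M\|_{\mathcal L(Y,Y)}\le c$ for all $y\in Y$, $M\in\partial^2\Psi(y)$. Set $\partial^2\Phi(y):=I+\partial^2\Psi(y)$. Algorithm (globalized inexact semismooth Newton method). Parameters: $\sigma\in(0,1/2)$, $\beta\in(0,1)$, $\eta\ge0$, $\tau\in(0,1]$. Choose $\xi_0\in Y$. For $k=0,1,2,\dots$: choose $M_k\in\partial^2\Phi(\xi_k)$; compute $d_k\in Y$ with $\|M_kd_k+\nabla\Phi(\xi_k)\|_Y\le\eta\|\nabla\Phi(\xi_k)\|_Y^{1+\tau}$ by the conjugate gradient (CG) method below applied to $M_kd=-\nabla\Phi(\xi_k)$ with tolerance $\delta_{CG}:=\eta\|\nabla\Phi(\xi_k)\|_Y^{1+\tau}$;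 compute the smallest $l_k\in\{0,1,2,\dots\}$ with $\Phi(\xi_k+\beta^{l_k}d_k)-\Phi(\xi_k)\le\sigma\beta^{l_k}\langle d_k,\nabla\Phi(\xi_k)\rangle$; set $t_k:=\beta^{l_k}$, $\xi_{k+1}:=\xi_k+t_kd_k$. It is assumed that the algorithm performs infinitely many steps, with $\nabla\Phi(\xi_k)\ne0$ for all $k$, and generates a sequence of iterates $(\xi_k)$. CG method for $Ax=b$. Input: tolerance $\delta_{CG}>0$. Set $x_0=0$, $r_0=b$, $p_0=r_0$, $j=0$. While $\|r_j\|>\delta_{CG}$: $\alpha_j=\|r_j\|^2/\langle Ap_j,p_j\rangle$, $x_{j+1}=x_j+\alpha_jp_j$, $r_{j+1}=r_j-\alpha_jAp_j$, $\beta_j=\|r_{j+1}\|^2/\|r_j\|^2$, $p_{j+1}=r_{j+1}+\beta_jp_j$, $j:=j+1$. The current $x_j$ is returned when the loop ends. (The scalars $\alpha_j,\beta_j$ are local to the CG method.)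
   Formalization: The formal theorem also assumes d_k ≠ 0 for all k: if η‖∇Φ(ξ_k)‖^τ ≥ 1, CG returns d_k = 0 without iterating and the method stalls forever away from the solution (e.g. S=0, g=0, z=0, η=10, τ=1, ξ_0=1). *)

theory Defs
  imports "HOL-Analysis.Analysis" "HOL-Library.Landau_Symbols"
begin

section \<open>Convex functions with values in the extended reals\<close>

definition proper_fun :: "('a \<Rightarrow> ereal) \<Rightarrow> bool" where
  "proper_fun h \<longleftrightarrow> (\<forall>x. h x \<noteq> -\<infinity>) \<and> (\<exists>x. h x < \<infinity>)"

(* HOL-Analysis has convex_on for real-valued functions only. *)
definition convex_fun :: "('a::real_vector \<Rightarrow> ereal) \<Rightarrow> bool" where
  "convex_fun h \<longleftrightarrow>
     (\<forall>x y t. 0 < t \<and> t < 1 \<longrightarrow>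
        h (t *\<^sub>R x + (1 - t) *\<^sub>R y) \<le> ereal t * h x + ereal (1 - t) * h y)"

definition lsc_fun :: "('a::topological_space \<Rightarrow> ereal) \<Rightarrow> bool" where
  "lsc_fun h \<longleftrightarrow> (\<forall>x. h x \<le> Liminf (at x) h)"

(* The infimum is finite and attained when h is proper, convex and lower semicontinuous
   on a Hilbert space. *)
definition env :: "('a::real_inner \<Rightarrow> ereal) \<Rightarrow> 'a \<Rightarrow> real" where
  "env h \<zeta> = real_of_ereal (INF x. ereal (1/2 * (norm (x - \<zeta>))\<^sup>2) + h x)"


section \<open>Gradients and second-order semismoothness\<close>

definition gradient :: "('a::real_inner \<Rightarrow> real) \<Rightarrow> 'a \<Rightarrow> 'a" where
  "gradient f x = (THE D. GDERIV f x :> D)"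

definition continuously_differentiable :: "('a::real_inner \<Rightarrow> real) \<Rightarrow> bool" where
  "continuously_differentiable f \<longleftrightarrow>
     (\<forall>x. \<exists>D. GDERIV f x :> D) \<and> continuous_on UNIV (gradient f)"

(* The suprema are taken in the extended reals, so that they are meaningful for unbounded
   families as well; "= o(...)" is written out with epsilon. *)
definition second_order_semismooth ::
  "('a::real_inner \<Rightarrow> real) \<Rightarrow> ('a \<Rightarrow> ('a \<Rightarrow>\<^sub>L 'a) set) \<Rightarrow> bool" where
  "second_order_semismooth T D2T \<longleftrightarrow>
     continuously_differentiable T \<and>
     (\<forall>y. D2T y \<noteq> {}) \<and>
     (\<forall>y. \<forall>\<epsilon>>0. \<forall>\<^sub>F h in at 0.
        (SUP M\<in>D2T (y + h).
           ereal \<bar>T (y + h) - T y - gradient T y \<bullet> h - 1/2 * (blinfun_apply M h \<bullet> h)\<bar>)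
          \<le> ereal (\<epsilon> * (norm h)\<^sup>2)) \<and>
     (\<forall>y. \<forall>\<epsilon>>0. \<forall>\<^sub>F h in at 0.
        (SUP M\<in>D2T (y + h).
           ereal (norm (gradient T (y + h) - gradient T y - blinfun_apply M h)))
          \<le> ereal (\<epsilon> * norm h))"

definition psd_operators :: "('a::real_inner \<Rightarrow>\<^sub>L 'a) set" where
  "psd_operators =
     {M. adjoint (blinfun_apply M) = blinfun_apply M \<and> (\<forall>y. blinfun_apply M y \<bullet> y \<ge> 0)}"


section \<open>The functionals\<close>

definition Psi ::
  "('u::real_inner \<Rightarrow>\<^sub>L 'y::real_inner) \<Rightarrow> real \<Rightarrow> ('u \<Rightarrow> ereal) \<Rightarrow> 'y \<Rightarrow> real" where
  "Psi S \<alpha> g \<xi> =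
     1 / (2 * \<alpha>) * (norm (adjoint (blinfun_apply S) \<xi>))\<^sup>2
     - \<alpha> * env (\<lambda>x. g x / ereal \<alpha>) ((1 / \<alpha>) *\<^sub>R adjoint (blinfun_apply S) \<xi>)"

definition Phi ::
  "('u::real_inner \<Rightarrow>\<^sub>L 'y::real_inner) \<Rightarrow> 'y \<Rightarrow> real \<Rightarrow> ('u \<Rightarrow> ereal) \<Rightarrow> 'y \<Rightarrow> real" where
  "Phi S z \<alpha> g \<xi> = 1/2 * (norm (\<xi> - z))\<^sup>2 - 1/2 * (norm z)\<^sup>2 + Psi S \<alpha> g \<xi>"

definition D2Phi :: "('a::real_normed_vector \<Rightarrow> ('a \<Rightarrow>\<^sub>L 'a) set) \<Rightarrow> 'a \<Rightarrow> ('a \<Rightarrow>\<^sub>L 'a) set" where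
  "D2Phi D2Psi y = (\<lambda>M. id_blinfun + M) ` D2Psi y"


section \<open>The conjugate gradient method\<close>

(* The state is the triple (x_j, r_j, p_j). *)
fun cg_step :: "('a::real_inner \<Rightarrow>\<^sub>L 'a) \<Rightarrow> 'a \<times> 'a \<times> 'a \<Rightarrow> 'a \<times> 'a \<times> 'a" where
  "cg_step A (x, r, p) =
     (let a = (norm r)\<^sup>2 / (blinfun_apply A p \<bullet> p);
          x' = x + a *\<^sub>R p;
          r' = r - a *\<^sub>R blinfun_apply A p;
          b = (norm r')\<^sup>2 / (norm r)\<^sup>2;
          p' = r' + b *\<^sub>R p
      in (x', r', p'))"

definition cg_state :: "('a::real_inner \<Rightarrow>\<^sub>L 'a) \<Rightarrow> 'a \<Rightarrow> nat \<Rightarrow> 'a \<times> 'a \<times> 'a" where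
  "cg_state A b j = (cg_step A ^^ j) (0, b, b)"

definition cg_iterate :: "('a::real_inner \<Rightarrow>\<^sub>L 'a) \<Rightarrow> 'a \<Rightarrow> nat \<Rightarrow> 'a" where
  "cg_iterate A b j = fst (cg_state A b j)"

definition cg_residual :: "('a::real_inner \<Rightarrow>\<^sub>L 'a) \<Rightarrow> 'a \<Rightarrow> nat \<Rightarrow> 'a" where
  "cg_residual A b j = fst (snd (cg_state A b j))"

(* The loop terminates, and it returns d. *)
definition cg_returns :: "('a::real_inner \<Rightarrow>\<^sub>L 'a) \<Rightarrow> 'a \<Rightarrow> real \<Rightarrow> 'a \<Rightarrow> bool" where
  "cg_returns A b \<delta> d \<longleftrightarrow>
     (\<exists>j. (\<forall>i<j. norm (cg_residual A b i) > \<delta>) \<and> norm (cg_residual A b j) \<le> \<delta>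
          \<and> d = cg_iterate A b j)"


section \<open>The globalized inexact semismooth Newton method\<close>

definition armijo :: "('a::real_inner \<Rightarrow> real) \<Rightarrow> real \<Rightarrow> real \<Rightarrow> 'a \<Rightarrow> 'a \<Rightarrow> nat \<Rightarrow> bool" where
  "armijo F \<sigma> \<beta> \<xi> d l \<longleftrightarrow>
     F (\<xi> + \<beta> ^ l *\<^sub>R d) - F \<xi> \<le> \<sigma> * \<beta> ^ l * (d \<bullet> gradient F \<xi>)"

(* The sequences of iterates xi, operators M, directions d and line search exponents l
   arise from one infinite run of the method applied to F. Pitfall: a run may stall. If the
   tolerance is at least the norm of the gradient, then CG returns d k = 0 without entering
   its loop, and the zero step is repeated forever; this predicate does not exclude that. *)
definition newton_run ::
  "('a::real_inner \<Rightarrow> real) \<Rightarrow> ('a \<Rightarrow> ('a \<Rightarrow>\<^sub>L 'a) set) \<Rightarrow> real \<Rightarrow> real \<Rightarrow> real \<Rightarrow> real \<Rightarrow>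
   (nat \<Rightarrow> 'a) \<Rightarrow> (nat \<Rightarrow> 'a \<Rightarrow>\<^sub>L 'a) \<Rightarrow> (nat \<Rightarrow> 'a) \<Rightarrow> (nat \<Rightarrow> nat) \<Rightarrow> bool" where
  "newton_run F D2F \<sigma> \<beta> \<eta> \<tau> \<xi> M d l \<longleftrightarrow>
     (\<forall>k. gradient F (\<xi> k) \<noteq> 0 \<and>
          M k \<in> D2F (\<xi> k) \<and>
          cg_returns (M k) (- gradient F (\<xi> k))
            (\<eta> * norm (gradient F (\<xi> k)) powr (1 + \<tau>)) (d k) \<and>
          norm (blinfun_apply (M k) (d k) + gradient F (\<xi> k))
            \<le> \<eta> * norm (gradient F (\<xi> k)) powr (1 + \<tau>) \<and>
          armijo F \<sigma> \<beta> (\<xi> k) (d k) (l k) \<and>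
          (\<forall>i<l k. \<not> armijo F \<sigma> \<beta> (\<xi> k) (d k) i) \<and>
          \<xi> (Suc k) = \<xi> k + \<beta> ^ l k *\<^sub>R d k)"

end

theory Submission
  imports Defs
begin

text \<open>
  The elements of \<open>\<partial>\<^sup>2\<Phi>\<close> are self-adjoint and lie between \<open>I\<close> and \<open>(1 + c) I\<close>. Semismoothness
  carries these bounds over to the increments of \<open>\<nabla>\<Phi>\<close> near each point, and along a segment the
  local inequalities add up. So \<open>\<nabla>\<Phi>\<close> is strongly monotone, and \<open>\<Phi>\<close> has quadratic lower and upper
  models at every point.

  A nonzero vector \<open>d\<close> returned by CG for \<open>M d = b\<close> is orthogonal to its residual, and
  \<open>\<langle>b, d\<rangle>\<close> is at least its value after one CG step. With \<open>b = - \<nabla>\<Phi>(\<xi>\<^sub>k)\<close>, this makes the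
  directions uniformly descending; the quadratic upper model bounds the step sizes from below, so
  \<open>\<nabla>\<Phi>(\<xi>\<^sub>k) \<longlongrightarrow> 0\<close>, and strong monotonicity gives convergence. Near the solution, semismoothness of
  the gradient and coercivity of \<open>M\<^sub>k\<close> make the full step superlinear, and the second-order
  expansion of \<open>\<Phi>\<close> with \<open>\<sigma> < 1/2\<close> shows that the line search accepts it.
\<close>

section \<open>Adjoints on Hilbert spaces\<close>

text \<open>For small t the linear term dominates the quadratic one. This serves as the first-order
  optimality condition in the Riesz argument.\<close>

lemma quadratic_nonneg_imp_linear_zero:
  fixes a b :: real
  assumes "\<And>t. 0 \<le> a * t + b * t\<^sup>2"
  shows "a = 0"
proof (rule ccontr)
  assume "a \<noteq> 0"
  \<comment> \<open>The summand 1 keeps \<open>c\<close> positive while b \<le> c, and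
    \<open>t\<close> is the minimizer of \<open>a * t + c * t\<^sup>2\<close>.\<close>
  define c where "c = \<bar>b\<bar> + 1"
  define t where "t = - a / (2 * c)"
  have "0 < c" by (simp add: c_def)
  have "a * t + b * t\<^sup>2 \<le> a * t + c * t\<^sup>2"
    by (intro add_left_mono mult_right_mono) (auto simp: c_def)
  also have "\<dots> = - (a\<^sup>2 / (4 * c))"
    using \<open>0 < c\<close> by (simp add: t_def power2_eq_square field_simps)
  also have "\<dots> < 0"
    using \<open>a \<noteq> 0\<close> \<open>0 < c\<close> by simp
  finally show False
    using assms[of t] by simp
qed

text \<open>The direct method: a minimizing sequence of a strongly convex functional is Cauchy,
  completeness supplies its limit, and stationarity there is the representation.\<close>

lemma riesz_representation:
  fixes f :: "'a::{real_inner,complete_space} \<Rightarrow> real"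
  assumes "bounded_linear f"
  obtains v where "\<And>x. f x = x \<bullet> v"
proof -
  interpret f: bounded_linear f by fact
  obtain K where K: "\<And>x. norm (f x) \<le> norm x * K"
    using f.bounded by blast
  \<comment> \<open>The representing vector is the minimizer of \<open>J\<close>.\<close>
  define J where "J x = (norm x)\<^sup>2 / 2 - f x" for x
  define m where "m = Inf (range J)"
  have lower: "- K\<^sup>2 / 2 \<le> J x" for x
  proof -
    have "f x \<le> norm x * K" using K[of x] by simp
    moreover have "0 \<le> (norm x - K)\<^sup>2" by simp
    ultimately show ?thesis by (simp add: J_def power2_eq_square algebra_simps)
  qed
  have bdd: "bdd_below (range J)"
    using lower by (intro bdd_belowI) auto
  have m_le: "m \<le> J x" for x
    unfolding m_def using bdd by (intro cInf_lower) auto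
  have "\<exists>x. J x < m + 1 / Suc n" for n
  proof -
    have "Inf (range J) < m + 1 / Suc n" by (simp add: m_def)
    then show ?thesis by (subst (asm) cInf_less_iff) (use bdd in auto)
  qed
  then obtain X where X: "\<And>n. J (X n) < m + 1 / Suc n"
    by metis
  \<comment> \<open>Parallelogram identity; the linear parts cancel. As \<open>J\<close> is at least
    \<open>m\<close> at the midpoint, two near-minimizers must be close.\<close>
  have par: "J x + J y - 2 * J ((1/2) *\<^sub>R (x + y)) = (norm (x - y))\<^sup>2 / 4" for x y
    unfolding J_def f.scaleR f.add
    by (simp add: power2_norm_eq_inner inner_simps inner_commute field_simps)
  have "Cauchy X"
  proof (rule metric_CauchyI)
    fix e :: real assume "e > 0"
    \<comment> \<open>Two values within \<open>1 / Suc n0\<close> of \<open>m\<close> bound the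
      squared distance by \<open>8 / Suc n0\<close>.\<close>
    obtain n0 where n0: "1 / Suc n0 < e\<^sup>2 / 8"
      using \<open>e > 0\<close> nat_approx_posE[of "e\<^sup>2 / 8"] by auto
    have "dist (X i) (X j) < e" if "i \<ge> n0" "j \<ge> n0" for i j
    proof -
      have *: "J (X i) < m + 1 / Suc n0" if "i \<ge> n0" for i
      proof -
        have "1 / real (Suc i) \<le> 1 / Suc n0"
          using that by (intro divide_left_mono) auto
        then show ?thesis using X[of i] by linarith
      qed
      have "(norm (X i - X j))\<^sup>2 / 4 < 2 * (1 / Suc n0)"
        using par[of "X i" "X j"] m_le[of "(1/2) *\<^sub>R (X i + X j)"]
          *[OF that(1)] *[OF that(2)] by linarith
      then have "(norm (X i - X j))\<^sup>2 < e\<^sup>2" using n0 by linarith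
      then show ?thesis
        using \<open>e > 0\<close> by (simp add: dist_norm power2_less_imp_less)
    qed
    then show "\<exists>M. \<forall>i\<ge>M. \<forall>j\<ge>M. dist (X i) (X j) < e" by blast
  qed
  then obtain v where v: "X \<longlonglongrightarrow> v"
    using Cauchy_convergent convergent_def by blast
  have "(\<lambda>n. J (X n)) \<longlonglongrightarrow> J v"
    unfolding J_def by (intro tendsto_intros f.tendsto v) auto
  moreover have "(\<lambda>n. m + 1 / Suc n) \<longlonglongrightarrow> m + 0"
    by (intro tendsto_intros LIMSEQ_Suc lim_1_over_n)
  ultimately have "J v \<le> m + 0"
    by (rule LIMSEQ_le) (use X less_imp_le in blast)
  then have min: "J v \<le> J x" for x
    using m_le[of x] by simp
  \<comment> \<open>First variation of \<open>J\<close> at its minimizer in the direction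
    \<open>x\<close>.\<close>
  have "v \<bullet> x - f x = 0" for x
  proof (rule quadratic_nonneg_imp_linear_zero)
    fix t :: real
    have "0 \<le> J (v + t *\<^sub>R x) - J v" using min by simp
    also have "\<dots> = (v \<bullet> x - f x) * t + ((norm x)\<^sup>2 / 2) * t\<^sup>2"
      unfolding J_def f.scaleR f.add power2_norm_eq_inner
      by (simp add: inner_simps inner_commute field_simps power2_eq_square)
    finally show "0 \<le> (v \<bullet> x - f x) * t + ((norm x)\<^sup>2 / 2) * t\<^sup>2" .
  qed
  then show ?thesis using that[of v] by (simp add: inner_commute)
qed

text \<open>\<open>adjoint\<close> is a chosen function and has its characteristic property only if
  some adjoint exists. Riesz representation provides one, pointwise in y.\<close>

lemma inner_adjoint_blinfun:
  fixes A :: "'a::{real_inner,complete_space} \<Rightarrow>\<^sub>L 'b::real_inner"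
  shows "blinfun_apply A x \<bullet> y = x \<bullet> adjoint (blinfun_apply A) y"
proof -
  have "\<exists>w. \<forall>x. blinfun_apply A x \<bullet> y = x \<bullet> w" for y
  proof -
    have "bounded_linear (\<lambda>x. blinfun_apply A x \<bullet> y)"
      by (intro bounded_linear_inner_left_comp blinfun.bounded_linear_right)
    then show ?thesis by (rule riesz_representation) metis
  qed
  then obtain B where "\<forall>x y. blinfun_apply A x \<bullet> y = x \<bullet> B y" by metis
  then show ?thesis using adjoint_unique by metis
qed

lemma psd_operators_symmetric:
  fixes N :: "'a::{real_inner,complete_space} \<Rightarrow>\<^sub>L 'a"
  assumes "N \<in> psd_operators"
  shows "blinfun_apply N u \<bullet> v = u \<bullet> blinfun_apply N v"
  using assms inner_adjoint_blinfun[of N u v] by (simp add: psd_operators_def)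

section \<open>Orthogonality in the conjugate gradient method\<close>

definition cg_direction :: "('a::real_inner \<Rightarrow>\<^sub>L 'a) \<Rightarrow> 'a \<Rightarrow> nat \<Rightarrow> 'a" where
  "cg_direction A b j = snd (snd (cg_state A b j))"

text \<open>The scalar \<open>\<alpha>\<^sub>j\<close> of the method; division by zero makes it 0
  when the direction vanishes.\<close>

definition cg_length :: "('a::real_inner \<Rightarrow>\<^sub>L 'a) \<Rightarrow> 'a \<Rightarrow> nat \<Rightarrow> real" where
  "cg_length A b j = (norm (cg_residual A b j))\<^sup>2 /
     (blinfun_apply A (cg_direction A b j) \<bullet> cg_direction A b j)"

lemma cg_0 [simp]:
  "cg_iterate A b 0 = 0" "cg_residual A b 0 = b" "cg_direction A b 0 = b"
  by (simp_all add: cg_iterate_def cg_residual_def cg_direction_def cg_state_def)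

lemma cg_Suc:
  "cg_iterate A b (Suc j) = cg_iterate A b j + cg_length A b j *\<^sub>R cg_direction A b j"
  "cg_residual A b (Suc j) =
     cg_residual A b j - cg_length A b j *\<^sub>R blinfun_apply A (cg_direction A b j)"
  "cg_direction A b (Suc j) = cg_residual A b (Suc j) +
     ((norm (cg_residual A b (Suc j)))\<^sup>2 / (norm (cg_residual A b j))\<^sup>2) *\<^sub>R cg_direction A b j"
proof -
  obtain x r p where "cg_state A b j = (x, r, p)" by (cases "cg_state A b j")
  moreover from this have "cg_state A b (Suc j) = cg_step A (x, r, p)"
    by (simp add: cg_state_def)
  ultimately show
    "cg_iterate A b (Suc j) = cg_iterate A b j + cg_length A b j *\<^sub>R cg_direction A b j"
    "cg_residual A b (Suc j) =
       cg_residual A b j - cg_length A b j *\<^sub>R blinfun_apply A (cg_direction A b j)"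
    "cg_direction A b (Suc j) = cg_residual A b (Suc j) +
       ((norm (cg_residual A b (Suc j)))\<^sup>2 / (norm (cg_residual A b j))\<^sup>2) *\<^sub>R cg_direction A b j"
    by (simp_all add: cg_iterate_def cg_residual_def cg_direction_def cg_length_def Let_def)
qed

lemma cg_residual_eq: "cg_residual A b j = b - blinfun_apply A (cg_iterate A b j)"
  by (induction j) (simp_all add: cg_Suc blinfun.bilinear_simps)

context
  fixes A :: "'a::real_inner \<Rightarrow>\<^sub>L 'a"
  assumes symmetric: "\<And>u v. blinfun_apply A u \<bullet> v = u \<bullet> blinfun_apply A v"
    and pos: "\<And>v. v \<noteq> 0 \<Longrightarrow> 0 < blinfun_apply A v \<bullet> v"
begin

text \<open>The four families support each other, so they share one induction. Nonzero earlier
  residuals make the step lengths nonzero, which permits cancelling them.\<close>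

lemma cg_orthogonality:
  assumes "\<And>i. i < j \<Longrightarrow> cg_residual A b i \<noteq> 0"
  shows "(\<forall>i<j. cg_residual A b j \<bullet> cg_direction A b i = 0) \<and>
    (\<forall>i<j. cg_residual A b j \<bullet> cg_residual A b i = 0) \<and>
    (\<forall>i<j. blinfun_apply A (cg_direction A b j) \<bullet> cg_direction A b i = 0) \<and>
    (\<forall>i\<le>j. cg_residual A b i \<bullet> cg_direction A b i = (norm (cg_residual A b i))\<^sup>2)"
  using assms
proof (induction j)
  case 0
  then show ?case by (simp add: power2_norm_eq_inner)
next
  case (Suc j)
  let ?r = "cg_residual A b" and ?p = "cg_direction A b" and ?a = "cg_length A b"
  from Suc.IH Suc.prems have
    rp: "\<And>i. i < j \<Longrightarrow> ?r j \<bullet> ?p i = 0" and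
    rr: "\<And>i. i < j \<Longrightarrow> ?r j \<bullet> ?r i = 0" and
    pp: "\<And>i. i < j \<Longrightarrow> blinfun_apply A (?p j) \<bullet> ?p i = 0" and
    rpi: "\<And>i. i \<le> j \<Longrightarrow> ?r i \<bullet> ?p i = (norm (?r i))\<^sup>2"
    by auto
  have r_ne: "?r i \<noteq> 0" if "i \<le> j" for i
    using Suc.prems that by simp
  have p_ne: "?p i \<noteq> 0" if "i \<le> j" for i
    using rpi[OF that] r_ne[OF that] by auto
  have Ap_pos: "0 < blinfun_apply A (?p i) \<bullet> ?p i" if "i \<le> j" for i
    using pos p_ne that by blast
  have a_Ap: "?a i * (blinfun_apply A (?p i) \<bullet> ?p i) = (norm (?r i))\<^sup>2" if "i \<le> j" for i
    using Ap_pos[OF that] by (simp add: cg_length_def)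
  have a_ne: "?a i \<noteq> 0" if "i \<le> j" for i
    using a_Ap[OF that] r_ne[OF that] by auto
  have Rp: "?r (Suc j) \<bullet> ?p i = 0" if "i \<le> j" for i
  proof (cases "i = j")
    case True
    then show ?thesis
      using rpi[of j] a_Ap[of j] by (simp add: cg_Suc inner_diff_left)
  next
    case False
    then show ?thesis using that rp pp by (simp add: cg_Suc inner_diff_left)
  qed
  \<comment> \<open>A residual is a combination of two successive directions, and the initial one is
    itself a direction; so \<open>Rp\<close> suffices.\<close>
  have Rr: "?r (Suc j) \<bullet> ?r i = 0" if "i \<le> j" for i
  proof (cases i)
    case 0
    then show ?thesis using Rp[of 0] by simp
  next
    case (Suc n)
    have "?r i = ?p i - ((norm (?r i))\<^sup>2 / (norm (?r n))\<^sup>2) *\<^sub>R ?p n"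
      using cg_Suc(3)[of A b n] Suc by (simp add: algebra_simps)
    moreover have "?r (Suc j) \<bullet> (?p i - s *\<^sub>R ?p n) = 0" for s
      using Rp[of i] Rp[of n] Suc that by (simp add: inner_diff_right)
    ultimately show ?thesis by metis
  qed
  have PP: "blinfun_apply A (?p (Suc j)) \<bullet> ?p i = 0" if "i \<le> j" for i
  proof -
    \<comment> \<open>After symmetry has moved \<open>A\<close> onto \<open>?p i\<close>, the
      residual recursion turns \<open>?a i\<close> times its image into a difference of residuals.
      Hence the factor \<open>?a i\<close>, cancelled at the end.\<close>
    have Ap: "?a i * (?r (Suc j) \<bullet> blinfun_apply A (?p i)) = ?r (Suc j) \<bullet> ?r i - ?r (Suc j) \<bullet> ?r (Suc i)"
      by (subst (4) cg_Suc) (simp add: inner_diff_right)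
    let ?s = "(norm (?r (Suc j)))\<^sup>2 / (norm (?r j))\<^sup>2"
    have split: "blinfun_apply A (?p (Suc j)) \<bullet> ?p i =
      ?r (Suc j) \<bullet> blinfun_apply A (?p i) + ?s * (blinfun_apply A (?p j) \<bullet> ?p i)"
      by (subst cg_Suc(3)) (simp add: blinfun.bilinear_simps inner_simps symmetric)
    show ?thesis
    proof (cases "i = j")
      case True
      \<comment> \<open>Only the term with \<open>?r (Suc j)\<close> survives, and the coefficient
        \<open>?s\<close> is the one that cancels it.\<close>
      have "?a j * (blinfun_apply A (?p (Suc j)) \<bullet> ?p j) =
        - (norm (?r (Suc j)))\<^sup>2 + ?s * (?a j * (blinfun_apply A (?p j) \<bullet> ?p j))"
        using Ap split Rr[of j] True by (simp add: algebra_simps power2_norm_eq_inner)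
      also have "\<dots> = 0" using a_Ap[of j] r_ne[of j] by simp
      finally show ?thesis using True a_ne[of j] by simp
    next
      case False
      then have "?a i * (?r (Suc j) \<bullet> blinfun_apply A (?p i)) = 0"
        using Ap Rr[of i] Rr[of "Suc i"] that by simp
      then show ?thesis using split a_ne[OF that] pp[of i] False that by simp
    qed
  qed
  have "?r (Suc j) \<bullet> ?p (Suc j) = (norm (?r (Suc j)))\<^sup>2"
    using Rp[of j] by (simp add: cg_Suc(3) inner_add_right power2_norm_eq_inner)
  then show ?case
    using Rp Rr PP rpi by (auto simp: less_Suc_eq_le le_Suc_eq)
qed

lemma cg_iterate_orthogonal_residual:
  assumes "\<And>i. i < j \<Longrightarrow> cg_residual A b i \<noteq> 0"
  shows "cg_residual A b j \<bullet> cg_iterate A b j = 0"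
proof -
  \<comment> \<open>Iterates are built from earlier directions, to which the last residual is
    orthogonal. The residual index stays fixed in this induction.\<close>
  have "i \<le> j \<Longrightarrow> cg_residual A b j \<bullet> cg_iterate A b i = 0" for i
    by (induction i) (use cg_orthogonality[OF assms] in \<open>auto simp: cg_Suc inner_add_right\<close>)
  then show ?thesis by simp
qed

text \<open>As the initial residual, \<open>b\<close> is orthogonal to all later ones. So the
  direction recursion only multiplies this inner product by nonnegative factors, starting from
  \<open>(norm b)\<^sup>2\<close>.\<close>

lemma cg_direction_inner_rhs_nonneg:
  assumes "\<And>i. i < j \<Longrightarrow> cg_residual A b i \<noteq> 0"
  shows "0 \<le> b \<bullet> cg_direction A b j"
  using assms
proof (induction j)
  case (Suc j)
  have "b \<bullet> cg_residual A b (Suc j) = 0"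
    using cg_orthogonality[of "Suc j" b] Suc.prems by (simp add: inner_commute) (metis cg_0(2) zero_less_Suc)
  then show ?case using Suc by (simp add: cg_Suc(3) inner_add_right)
qed simp

lemma cg_iterate_inner_rhs_mono:
  assumes "1 \<le> j" and "\<And>i. i < j \<Longrightarrow> cg_residual A b i \<noteq> 0"
  shows "b \<bullet> cg_iterate A b 1 \<le> b \<bullet> cg_iterate A b j"
  using assms
proof (induction j rule: dec_induct)
  case (step j)
  have "0 \<le> cg_length A b j"
    using pos[of "cg_direction A b j"]
    by (cases "cg_direction A b j = 0") (auto simp: cg_length_def)
  moreover have "0 \<le> b \<bullet> cg_direction A b j"
    by (rule cg_direction_inner_rhs_nonneg) (use step.prems in auto)
  ultimately show ?case using step by (auto simp: cg_Suc inner_add_right intro: add_increasing2)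
qed simp

text \<open>A nonzero result means that at least one CG step was made. Orthogonality of residual and
  iterate gives the identity; monotonicity reduces the inequality to the first step, which goes
  along \<open>b\<close>.\<close>

lemma cg_returns_descent:
  assumes cg: "cg_returns A b \<delta> d" and "0 \<le> \<delta>" and "d \<noteq> 0"
    and bound: "\<And>v. blinfun_apply A v \<bullet> v \<le> L * (norm v)\<^sup>2"
  shows "blinfun_apply A d \<bullet> d = b \<bullet> d" and "(norm b)\<^sup>2 \<le> L * (b \<bullet> d)"
proof -
  obtain j where j: "\<And>i. i < j \<Longrightarrow> norm (cg_residual A b i) > \<delta>" and d: "d = cg_iterate A b j"
    using cg unfolding cg_returns_def by auto
  have ne: "cg_residual A b i \<noteq> 0" if "i < j" for i
    using j[OF that] \<open>0 \<le> \<delta>\<close> by auto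
  have "j \<noteq> 0" using d \<open>d \<noteq> 0\<close> by (metis cg_0(1))
  show "blinfun_apply A d \<bullet> d = b \<bullet> d"
    using cg_iterate_orthogonal_residual[of j b, OF ne] cg_residual_eq[of A b j]
    by (simp add: d inner_diff_left)
  have "b \<noteq> 0" using ne[of 0] \<open>j \<noteq> 0\<close> by simp
  then have pos_b: "0 < blinfun_apply A b \<bullet> b" and "0 < (norm b)\<^sup>2" using pos by auto
  then have "0 < L" using bound[of b] by (meson less_le_trans zero_less_mult_pos2)
  \<comment> \<open>The first iterate is b scaled by \<open>(norm b)\<^sup>2\<close> / \<langle>A b,
    b\<rangle>, and the denominator is at most \<open>L * (norm b)\<^sup>2\<close>.\<close>
  have "(norm b)\<^sup>2 * (blinfun_apply A b \<bullet> b) \<le> (norm b)\<^sup>2 * (L * (norm b)\<^sup>2)"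
    by (intro mult_left_mono bound) simp
  then have "(norm b)\<^sup>2 \<le> L * (b \<bullet> cg_iterate A b 1)"
    using pos_b by (simp add: cg_Suc cg_length_def field_simps flip: power2_norm_eq_inner)
  also have "\<dots> \<le> L * (b \<bullet> d)"
    unfolding d using ne \<open>j \<noteq> 0\<close> \<open>0 < L\<close>
    by (intro mult_left_mono cg_iterate_inner_rhs_mono) auto
  finally show "(norm b)\<^sup>2 \<le> L * (b \<bullet> d)" .
qed

end

section \<open>From local to global monotonicity\<close>

text \<open>Values are compared only with that at the centre t, which is what \<open>Bolzano\<close>
  asks for: short intervals containing t are split at t, and the inequalities chain.\<close>

lemma locally_nondecreasing_imp_le:
  fixes f :: "real \<Rightarrow> real"
  assumes local: "\<And>t. \<exists>\<delta>>0. \<forall>s. \<bar>s\<bar> < \<delta> \<longrightarrow> 0 \<le> s * (f (t + s) - f t)"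
    and "a \<le> b"
  shows "f a \<le> f b"
  using \<open>a \<le> b\<close>
proof (rule Bolzano[where P = "\<lambda>u v. u \<le> v \<longrightarrow> f u \<le> f v", THEN mp])
  fix t
  obtain \<delta> where "\<delta> > 0" and \<delta>: "\<And>s. \<bar>s\<bar> < \<delta> \<Longrightarrow> 0 \<le> s * (f (t + s) - f t)"
    using assms(1) by blast
  have "f u \<le> f v" if "u \<le> t" "t \<le> v" "v - u < \<delta>" for u v
  proof -
    have "f u \<le> f t"
      using \<delta>[of "u - t"] that by (cases "u = t") (auto simp: zero_le_mult_iff)
    also have "f t \<le> f v"
      using \<delta>[of "v - t"] that by (cases "v = t") (auto simp: zero_le_mult_iff)
    finally show ?thesis .
  qed
  then show "\<exists>\<delta>>0. \<forall>u v. u \<le> t \<and> t \<le> v \<and> v - u < \<delta> \<longrightarrow> u \<le> v \<longrightarrow> f u \<le> f v"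
    using \<open>\<delta> > 0\<close> by auto
qed (use \<open>a \<le> b\<close> in auto)

text \<open>The loss \<epsilon> is relative to \<open>(norm h)\<^sup>2\<close>, so it does not
  accumulate along the segment and can be sent to 0 at the end. The modulus \<open>m\<close> may be
  negative.\<close>

lemma strongly_monotone_if_locally:
  fixes G :: "'a::real_inner \<Rightarrow> 'a"
  assumes local: "\<And>x \<epsilon>. 0 < \<epsilon> \<Longrightarrow>
    \<forall>\<^sub>F h in at 0. (m - \<epsilon>) * (norm h)\<^sup>2 \<le> (G (x + h) - G x) \<bullet> h"
  shows "m * (norm (y - x))\<^sup>2 \<le> (G y - G x) \<bullet> (y - x)"
proof -
  define v where "v = y - x"
  have "(m - \<epsilon>) * (norm v)\<^sup>2 \<le> (G y - G x) \<bullet> v" if "0 < \<epsilon>" for \<epsilon>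
  proof -
    let ?f = "\<lambda>t. G (x + t *\<^sub>R v) \<bullet> v - (m - \<epsilon>) * (norm v)\<^sup>2 * t"
    have "?f 0 \<le> ?f 1"
    proof (rule locally_nondecreasing_imp_le[where f = ?f])
      fix t
      obtain \<delta> where "\<delta> > 0" and
        \<delta>: "\<And>h. h \<noteq> 0 \<Longrightarrow> norm h < \<delta> \<Longrightarrow>
          (m - \<epsilon>) * (norm h)\<^sup>2 \<le> (G (x + t *\<^sub>R v + h) - G (x + t *\<^sub>R v)) \<bullet> h"
        using local[OF \<open>0 < \<epsilon>\<close>, of "x + t *\<^sub>R v"] by (auto simp: eventually_at)
      \<comment> \<open>Adding 1 to the norm gives a positive radius also for
        \<open>v = 0\<close>.\<close>
      have "0 \<le> s * (?f (t + s) - ?f t)" if "\<bar>s\<bar> < \<delta> / (norm v + 1)" for s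
      proof (cases "s *\<^sub>R v = 0")
        case False
        have "\<bar>s\<bar> * norm v \<le> \<bar>s\<bar> * (norm v + 1)" by (intro mult_left_mono) auto
        also have "\<dots> < \<delta>" using that by (simp add: pos_less_divide_eq add_nonneg_pos)
        finally have "norm (s *\<^sub>R v) < \<delta>" by simp
        from \<delta>[OF False this] show ?thesis
          by (simp add: scaleR_left_distrib add.assoc inner_diff_left power_mult_distrib)
            (simp add: algebra_simps power2_eq_square)
      qed auto
      moreover have "0 < \<delta> / (norm v + 1)"
        using \<open>\<delta> > 0\<close> by (simp add: add_nonneg_pos)
      ultimately show "\<exists>\<delta>>0. \<forall>s. \<bar>s\<bar> < \<delta> \<longrightarrow> 0 \<le> s * (?f (t + s) - ?f t)"
        by blast
    qed simp
    then show ?thesis by (simp add: v_def inner_simps)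
  qed
  then have "\<forall>\<epsilon>>0. m * (norm v)\<^sup>2 - (G y - G x) \<bullet> v \<le> \<epsilon> * (norm v)\<^sup>2"
    by (simp add: algebra_simps)
  \<comment> \<open>Rescaling \<epsilon> by \<open>(norm v)\<^sup>2\<close> makes the bound
    absolute.\<close>
  then have "m * (norm v)\<^sup>2 - (G y - G x) \<bullet> v \<le> \<epsilon>" if "0 < \<epsilon>" for \<epsilon>
  proof (cases "v = 0")
    case False
    with \<open>\<forall>\<epsilon>>0. _\<close>[rule_format, of "\<epsilon> / (norm v)\<^sup>2"] that show ?thesis by simp
  qed (use that in auto)
  then show ?thesis
    using field_le_epsilon[of "m * (norm v)\<^sup>2 - (G y - G x) \<bullet> v" 0] by (simp add: v_def)
qed

text \<open>By monotonicity, F minus its model has nonnegative derivative along the segment. With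
  negative \<open>m\<close>, applied to -F, this yields an upper model.\<close>

lemma quadratic_lower_bound:
  fixes F :: "'a::real_inner \<Rightarrow> real"
  assumes G: "\<And>x. GDERIV F x :> G x"
    and mono: "\<And>x y. m * (norm (y - x))\<^sup>2 \<le> (G y - G x) \<bullet> (y - x)"
  shows "F x + G x \<bullet> h + m / 2 * (norm h)\<^sup>2 \<le> F (x + h)"
proof -
  let ?f = "\<lambda>t. F (x + t *\<^sub>R h) - t * (G x \<bullet> h) - m / 2 * (norm h)\<^sup>2 * t\<^sup>2"
  have "?f 0 \<le> ?f 1"
  proof (rule DERIV_nonneg_imp_nondecreasing[where f = ?f])
    fix t :: real assume "0 \<le> t"
    have "((\<lambda>t. F (x + t *\<^sub>R h)) has_derivative (\<lambda>s. (s *\<^sub>R h) \<bullet> G (x + t *\<^sub>R h))) (at t)"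
      by (rule has_derivative_compose[where f = "\<lambda>t. x + t *\<^sub>R h"])
        (auto intro!: derivative_eq_intros G[unfolded gderiv_def])
    then have "((\<lambda>t. F (x + t *\<^sub>R h)) has_real_derivative G (x + t *\<^sub>R h) \<bullet> h) (at t)"
      unfolding has_field_derivative_def
      by (rule has_derivative_eq_rhs) (simp add: fun_eq_iff inner_commute)
    then have "(?f has_real_derivative
        G (x + t *\<^sub>R h) \<bullet> h - G x \<bullet> h - m * (norm h)\<^sup>2 * t) (at t)"
      by (auto intro!: derivative_eq_intros)
    moreover have "0 \<le> G (x + t *\<^sub>R h) \<bullet> h - G x \<bullet> h - m * (norm h)\<^sup>2 * t"
    proof (cases "t = 0")
      case False
      \<comment> \<open>Monotonicity between x and x + t h carries a factor t, which is divided
        out.\<close>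
      have "0 \<le> t * (G (x + t *\<^sub>R h) \<bullet> h - G x \<bullet> h - m * (norm h)\<^sup>2 * t)"
        using mono[where x = x and y = "x + t *\<^sub>R h"]
        by (simp add: inner_simps power_mult_distrib power2_eq_square algebra_simps)
      then show ?thesis using False \<open>0 \<le> t\<close> by (simp add: zero_le_mult_iff)
    qed simp
    ultimately show "\<exists>y. DERIV ?f t :> y \<and> 0 \<le> y" by blast
  qed simp
  then show ?thesis by simp
qed

section \<open>Gradients, and adding a quadratic to a semismooth function\<close>

lemma gradient_eqI:
  assumes "GDERIV F x :> D"
  shows "gradient F x = D"
  unfolding gradient_def
proof (rule the_equality)
  fix D' assume "GDERIV F x :> D'"
  then have "(\<lambda>h. h \<bullet> D') = (\<lambda>h. h \<bullet> D)"
    using assms unfolding gderiv_def by (rule has_derivative_unique)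
  then have "(D' - D) \<bullet> D' = (D' - D) \<bullet> D" by meson
  then have "(D' - D) \<bullet> (D' - D) = 0" by (simp add: inner_diff_right)
  then show "D' = D" by simp
qed (fact assms)

lemma continuously_differentiable_gderiv:
  "continuously_differentiable F \<Longrightarrow> GDERIV F x :> gradient F x"
  unfolding continuously_differentiable_def using gradient_eqI by metis

lemma gradient_add_quadratic:
  assumes "GDERIV T x :> G"
  shows "GDERIV (\<lambda>\<xi>. 1/2 * (norm (\<xi> - z))\<^sup>2 - 1/2 * (norm z)\<^sup>2 + T \<xi>) x :> x - z + G"
  using assms unfolding gderiv_def power2_norm_eq_inner
  by (auto intro!: derivative_eq_intros simp: inner_simps inner_commute algebra_simps)

text \<open>A quadratic with Hessian I equals its second-order expansion, so both remainders are
  exactly those of \<open>T\<close>.\<close>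

lemma second_order_semismooth_add_quadratic:
  fixes T :: "'a::real_inner \<Rightarrow> real"
  assumes "second_order_semismooth T D2T"
  shows "second_order_semismooth
    (\<lambda>\<xi>. 1/2 * (norm (\<xi> - z))\<^sup>2 - 1/2 * (norm z)\<^sup>2 + T \<xi>) (\<lambda>y. (\<lambda>N. id_blinfun + N) ` D2T y)"
proof -
  define F where "F \<xi> = 1/2 * (norm (\<xi> - z))\<^sup>2 - 1/2 * (norm z)\<^sup>2 + T \<xi>" for \<xi>
  have cd: "continuously_differentiable T"
    using assms by (auto simp: second_order_semismooth_def)
  have gF: "GDERIV F x :> x - z + gradient T x" for x
    unfolding F_def using cd by (intro gradient_add_quadratic continuously_differentiable_gderiv)
  have gradF: "gradient F x = x - z + gradient T x" for x
    by (rule gradient_eqI) (fact gF)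
  have "continuous_on UNIV (gradient T)"
    using cd by (simp add: continuously_differentiable_def)
  then have "continuous_on UNIV (\<lambda>x. x - z + gradient T x)"
    by (intro continuous_intros)
  then have "continuously_differentiable F"
    unfolding continuously_differentiable_def gradF using gF by blast
  moreover have "F (y + h) - F y - gradient F y \<bullet> h
      - 1/2 * (blinfun_apply (id_blinfun + N) h \<bullet> h)
    = T (y + h) - T y - gradient T y \<bullet> h - 1/2 * (blinfun_apply N h \<bullet> h)" for y h N
    unfolding gradF F_def
    by (simp add: power2_norm_eq_inner blinfun.add_left inner_simps inner_commute field_simps)
  moreover have "gradient F (y + h) - gradient F y - blinfun_apply (id_blinfun + N) h
    = gradient T (y + h) - gradient T y - blinfun_apply N h" for y h N
    unfolding gradF by (simp add: blinfun.add_left)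
  ultimately have "second_order_semismooth F (\<lambda>y. (\<lambda>N. id_blinfun + N) ` D2T y)"
    using assms unfolding second_order_semismooth_def image_image
    by (simp only: image_is_empty) blast
  then show ?thesis by (simp only: F_def[abs_def])
qed

section \<open>Convergence of the Newton method\<close>

text \<open>This isolates what the convergence proof uses of \<Phi>. The coercivity constant 1 comes
  from the identity in \<open>\<partial>\<^sup>2\<Phi>\<close>; \<open>L\<close> becomes 1 +
  c.\<close>

locale strongly_convex_semismooth =
  fixes F :: "'a::real_inner \<Rightarrow> real" and D2F :: "'a \<Rightarrow> ('a \<Rightarrow>\<^sub>L 'a) set" and L :: real
  assumes semismooth: "second_order_semismooth F D2F"
    and symmetric: "N \<in> D2F y \<Longrightarrow> blinfun_apply N u \<bullet> v = u \<bullet> blinfun_apply N v"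
    and coercive: "N \<in> D2F y \<Longrightarrow> (norm v)\<^sup>2 \<le> blinfun_apply N v \<bullet> v"
    and bounded: "N \<in> D2F y \<Longrightarrow> norm N \<le> L"
begin

lemma gderiv: "GDERIV F x :> gradient F x"
  using semismooth
  by (intro continuously_differentiable_gderiv) (simp add: second_order_semismooth_def)

lemma D2F_nonempty: "D2F y \<noteq> {}"
  using semismooth by (simp add: second_order_semismooth_def)

lemma inner_bound:
  assumes "N \<in> D2F y"
  shows "\<bar>blinfun_apply N u \<bullet> v\<bar> \<le> L * norm u * norm v"
proof -
  have "\<bar>blinfun_apply N u \<bullet> v\<bar> \<le> norm (blinfun_apply N u) * norm v"
    by (rule Cauchy_Schwarz_ineq2)
  also have "norm (blinfun_apply N u) \<le> norm N * norm u"
    by (rule norm_blinfun)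
  also have "norm N * norm u \<le> L * norm u"
    using bounded[OF assms] by (intro mult_right_mono) auto
  finally show ?thesis by (simp add: mult_right_mono)
qed

lemma curvature_le: "N \<in> D2F y \<Longrightarrow> blinfun_apply N v \<bullet> v \<le> L * (norm v)\<^sup>2"
  using inner_bound[of N y v v] by (simp add: power2_eq_square)

text \<open>At h = 0 both sides vanish, so the punctured filter may be replaced by
  \<open>nhds 0\<close>; the estimate then composes with any increments tending to 0.\<close>

lemma value_approx:
  assumes "0 < \<epsilon>"
  shows "\<forall>\<^sub>F h in nhds 0. \<forall>N\<in>D2F (y + h).
    \<bar>F (y + h) - F y - gradient F y \<bullet> h - 1/2 * (blinfun_apply N h \<bullet> h)\<bar> \<le> \<epsilon> * (norm h)\<^sup>2"
proof -
  have "\<forall>\<^sub>F h in at 0. (SUP N\<in>D2F (y + h).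
      ereal \<bar>F (y + h) - F y - gradient F y \<bullet> h - 1/2 * (blinfun_apply N h \<bullet> h)\<bar>)
      \<le> ereal (\<epsilon> * (norm h)\<^sup>2)"
    using semismooth assms by (simp add: second_order_semismooth_def)
  then show ?thesis
    unfolding eventually_at_filter
    by (rule eventually_mono) (auto simp: SUP_le_iff)
qed

lemma gradient_approx:
  assumes "0 < \<epsilon>"
  shows "\<forall>\<^sub>F h in nhds 0. \<forall>N\<in>D2F (y + h).
    norm (gradient F (y + h) - gradient F y - blinfun_apply N h) \<le> \<epsilon> * norm h"
proof -
  have "\<forall>\<^sub>F h in at 0. (SUP N\<in>D2F (y + h).
      ereal (norm (gradient F (y + h) - gradient F y - blinfun_apply N h)))
      \<le> ereal (\<epsilon> * norm h)"
    using semismooth assms by (simp add: second_order_semismooth_def)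
  then show ?thesis
    unfolding eventually_at_filter
    by (rule eventually_mono) (auto simp: SUP_le_iff blinfun.bilinear_simps)
qed

text \<open>Any \<open>N\<close> at x + h maps h to the gradient increment up to
  \<open>\<epsilon> * norm h\<close>, and its quadratic form lies between 1 and \<open>L\<close>
  times \<open>(norm h)\<^sup>2\<close>.\<close>

lemma gradient_increment_local:
  assumes "0 < \<epsilon>"
  shows "\<forall>\<^sub>F h in at 0.
    (1 - \<epsilon>) * (norm h)\<^sup>2 \<le> (gradient F (x + h) - gradient F x) \<bullet> h \<and>
    (gradient F (x + h) - gradient F x) \<bullet> h \<le> (L + \<epsilon>) * (norm h)\<^sup>2"
proof (rule filter_leD[OF at_within_le_nhds eventually_mono[OF gradient_approx[OF assms]]])
  fix h
  assume approx: "\<forall>N\<in>D2F (x + h).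
    norm (gradient F (x + h) - gradient F x - blinfun_apply N h) \<le> \<epsilon> * norm h"
  obtain N where N: "N \<in> D2F (x + h)" using D2F_nonempty by blast
  have "\<bar>(gradient F (x + h) - gradient F x - blinfun_apply N h) \<bullet> h\<bar>
      \<le> norm (gradient F (x + h) - gradient F x - blinfun_apply N h) * norm h"
    by (rule Cauchy_Schwarz_ineq2)
  also have "\<dots> \<le> \<epsilon> * norm h * norm h"
    using approx N by (intro mult_right_mono) auto
  finally have "\<bar>(gradient F (x + h) - gradient F x - blinfun_apply N h) \<bullet> h\<bar> \<le> \<epsilon> * (norm h)\<^sup>2"
    by (simp add: power2_eq_square)
  then show "(1 - \<epsilon>) * (norm h)\<^sup>2 \<le> (gradient F (x + h) - gradient F x) \<bullet> h \<and>
    (gradient F (x + h) - gradient F x) \<bullet> h \<le> (L + \<epsilon>) * (norm h)\<^sup>2"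
    using coercive[OF N, of h] curvature_le[OF N, of h]
    by (simp add: inner_diff_left algebra_simps abs_le_iff)
qed

lemma gradient_strongly_monotone:
  "(norm (y - x))\<^sup>2 \<le> (gradient F y - gradient F x) \<bullet> (y - x)"
proof -
  have "1 * (norm (y - x))\<^sup>2 \<le> (gradient F y - gradient F x) \<bullet> (y - x)"
    by (rule strongly_monotone_if_locally)
      (rule eventually_mono[OF gradient_increment_local], auto)
  then show ?thesis by simp
qed

text \<open>The passage from local to global, applied to the negative gradient with modulus
  -L.\<close>

lemma gradient_increment_le:
  "(gradient F y - gradient F x) \<bullet> (y - x) \<le> L * (norm (y - x))\<^sup>2"
proof -
  have "- L * (norm (y - x))\<^sup>2 \<le> (- gradient F y - - gradient F x) \<bullet> (y - x)"
  proof (rule strongly_monotone_if_locally)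
    fix x \<epsilon> assume "0 < (\<epsilon>::real)"
    show "\<forall>\<^sub>F h in at 0. (- L - \<epsilon>) * (norm h)\<^sup>2 \<le> (- gradient F (x + h) - - gradient F x) \<bullet> h"
      by (rule eventually_mono[OF gradient_increment_local[OF \<open>0 < \<epsilon>\<close>, of x]])
        (auto simp: inner_diff_left algebra_simps)
  qed
  then show ?thesis by (simp add: inner_diff_left algebra_simps)
qed

lemma lower_bound: "F x + gradient F x \<bullet> h + 1/2 * (norm h)\<^sup>2 \<le> F (x + h)"
  using quadratic_lower_bound[OF gderiv, of 1] gradient_strongly_monotone by simp

lemma upper_bound: "F (x + h) \<le> F x + gradient F x \<bullet> h + L/2 * (norm h)\<^sup>2"
proof -
  have "- F x + - gradient F x \<bullet> h + - L / 2 * (norm h)\<^sup>2 \<le> - F (x + h)"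
  proof (rule quadratic_lower_bound)
    show "- L * (norm (y - x))\<^sup>2 \<le> (- gradient F y - - gradient F x) \<bullet> (y - x)" for x y
      using gradient_increment_le[of y x] by (simp add: inner_diff_left algebra_simps)
  qed (intro GDERIV_minus gderiv)
  then show ?thesis by simp
qed

end

text \<open>\<open>d_nonzero\<close> rules out runs that stall at a zero direction, so CG always
  makes at least one step.\<close>

locale newton_cg_run = strongly_convex_semismooth F D2F L
  for F :: "'a::real_inner \<Rightarrow> real" and D2F :: "'a \<Rightarrow> ('a \<Rightarrow>\<^sub>L 'a) set" and L :: real +
  fixes \<sigma> \<beta> \<eta> \<tau> :: real and \<xi>bar :: 'a and \<xi> d :: "nat \<Rightarrow> 'a"
    and M :: "nat \<Rightarrow> 'a \<Rightarrow>\<^sub>L 'a" and l :: "nat \<Rightarrow> nat"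
  assumes sigma: "0 < \<sigma>" "\<sigma> < 1/2"
    and beta: "0 < \<beta>" "\<beta> < 1"
    and eta: "0 \<le> \<eta>"
    and tau: "0 < \<tau>"
    and solution: "gradient F \<xi>bar = 0"
    and run: "newton_run F D2F \<sigma> \<beta> \<eta> \<tau> \<xi> M d l"
    and d_nonzero: "d k \<noteq> 0"
begin

lemma M_in: "M k \<in> D2F (\<xi> k)"
  and cg: "cg_returns (M k) (- gradient F (\<xi> k))
    (\<eta> * norm (gradient F (\<xi> k)) powr (1 + \<tau>)) (d k)"
  and residual: "norm (blinfun_apply (M k) (d k) + gradient F (\<xi> k))
    \<le> \<eta> * norm (gradient F (\<xi> k)) powr (1 + \<tau>)"
  and armijo: "armijo F \<sigma> \<beta> (\<xi> k) (d k) (l k)"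
  and not_armijo: "i < l k \<Longrightarrow> \<not> armijo F \<sigma> \<beta> (\<xi> k) (d k) i"
  and xi_Suc: "\<xi> (Suc k) = \<xi> k + \<beta> ^ l k *\<^sub>R d k"
  using run by (auto simp: newton_run_def)

lemma L_ge_1: "1 \<le> L"
proof -
  have "1 * (norm (d 0))\<^sup>2 \<le> L * (norm (d 0))\<^sup>2"
    using coercive[OF M_in, of "d 0" 0] curvature_le[OF M_in, of 0 "d 0"] by simp
  then show ?thesis
    using d_nonzero[of 0] by (subst (asm) mult_le_cancel_right) auto
qed

lemma
  shows curvature_eq: "blinfun_apply (M k) (d k) \<bullet> d k = - (gradient F (\<xi> k) \<bullet> d k)"
    and gradient_descent: "(norm (gradient F (\<xi> k)))\<^sup>2 \<le> L * - (gradient F (\<xi> k) \<bullet> d k)"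
proof -
  have pos: "0 < blinfun_apply (M k) v \<bullet> v" if "v \<noteq> 0" for v
    using coercive[OF M_in, of v k] that by (auto intro: less_le_trans[of _ "(norm v)\<^sup>2"])
  have "0 \<le> \<eta> * norm (gradient F (\<xi> k)) powr (1 + \<tau>)" using eta by simp
  note * = cg_returns_descent[OF symmetric[OF M_in] pos cg this d_nonzero curvature_le[OF M_in]]
  show "blinfun_apply (M k) (d k) \<bullet> d k = - (gradient F (\<xi> k) \<bullet> d k)"
    using *(1) by simp
  show "(norm (gradient F (\<xi> k)))\<^sup>2 \<le> L * - (gradient F (\<xi> k) \<bullet> d k)"
    using *(2) by simp
qed

section \<open>Step sizes and global convergence\<close>

lemma direction_descent: "(norm (d k))\<^sup>2 \<le> - (gradient F (\<xi> k) \<bullet> d k)"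
  using coercive[OF M_in] curvature_eq by metis

text \<open>A rejected trial step exceeds 2 (1 - \<sigma>) / L, and the accepted step is \<beta>
  times the last rejected one; the value 1 covers immediate acceptance.\<close>

definition min_step :: real where
  "min_step = min 1 (\<beta> * (2 * (1 - \<sigma>) / L))"

lemma min_step_pos: "0 < min_step"
  using sigma beta L_ge_1 by (simp add: min_step_def)

lemma min_step_le: "min_step \<le> \<beta> ^ l k"
proof (cases "l k")
  case (Suc i)
  define t where "t = \<beta> ^ i"
  define s where "s = - (gradient F (\<xi> k) \<bullet> d k)"
  have "0 < t" using beta by (simp add: t_def)
  have d_le: "(norm (d k))\<^sup>2 \<le> s" using direction_descent by (simp add: s_def)
  moreover have "0 < (norm (d k))\<^sup>2" using d_nonzero by simp
  ultimately have "0 < s" by linarith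
  \<comment> \<open>By minimality of \<open>l k\<close>, the preceding exponent \<open>i\<close> was
    rejected; this is played against the quadratic upper model.\<close>
  have "- \<sigma> * t * s < F (\<xi> k + t *\<^sub>R d k) - F (\<xi> k)"
    using not_armijo[of i k] Suc
    by (simp add: armijo_def t_def s_def inner_commute)
  also have "\<dots> \<le> - t * s + L/2 * (t\<^sup>2 * (norm (d k))\<^sup>2)"
    using upper_bound[of "\<xi> k" "t *\<^sub>R d k"] by (simp add: s_def power_mult_distrib)
  \<comment> \<open>Now every term is a multiple of \<open>t * s\<close>, which divides out.\<close>
  also have "\<dots> \<le> - t * s + L/2 * (t\<^sup>2 * s)"
    using d_le L_ge_1 by (intro add_left_mono mult_left_mono) auto
  finally have "(t * s) * (1 - \<sigma>) < (t * s) * (L/2 * t)"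
    by (simp add: power2_eq_square algebra_simps)
  then have "1 - \<sigma> < L/2 * t"
    using \<open>0 < t\<close> \<open>0 < s\<close> by (subst (asm) mult_less_cancel_left_pos) auto
  then have "2 * (1 - \<sigma>) / L \<le> t"
    using L_ge_1 by (simp add: field_simps)
  then have "\<beta> * (2 * (1 - \<sigma>) / L) \<le> \<beta> * t"
    using beta by (intro mult_left_mono) auto
  then show ?thesis by (simp add: min_step_def Suc t_def)
qed (simp add: min_step_def)

text \<open>Armijo turns slope into decrease; CG bounds the slope by the squared gradient, and
  \<open>min_step\<close> bounds the step.\<close>

lemma decrease:
  "F (\<xi> (Suc k)) \<le> F (\<xi> k) - \<sigma> * min_step / L * (norm (gradient F (\<xi> k)))\<^sup>2"
proof -
  define s where "s = - (gradient F (\<xi> k) \<bullet> d k)"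
  have "0 \<le> s"
    using direction_descent[of k] zero_le_power2[of "norm (d k)"] unfolding s_def by linarith
  have "(norm (gradient F (\<xi> k)))\<^sup>2 / L \<le> s"
    using gradient_descent[of k] L_ge_1 by (simp add: s_def field_simps)
  then have "\<sigma> * min_step * ((norm (gradient F (\<xi> k)))\<^sup>2 / L) \<le> \<sigma> * min_step * s"
    using sigma min_step_pos by (intro mult_left_mono) auto
  also have "\<dots> \<le> \<sigma> * \<beta> ^ l k * s"
    using sigma min_step_le \<open>0 \<le> s\<close> by (intro mult_left_mono mult_right_mono) auto
  also have "\<dots> \<le> F (\<xi> k) - F (\<xi> (Suc k))"
    using armijo[of k] by (simp add: armijo_def xi_Suc s_def inner_commute)
  finally show ?thesis by simp
qed

text \<open>The values decrease and stay above \<open>F \<xi>bar\<close>, so they converge and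
  successive differences tend to 0; by \<open>decrease\<close> these dominate the squared
  gradient.\<close>

lemma gradient_tendsto: "(\<lambda>k. norm (gradient F (\<xi> k))) \<longlonglongrightarrow> 0"
proof -
  define q where "q = \<sigma> * min_step / L"
  have "0 < q" using sigma min_step_pos L_ge_1 by (simp add: q_def)
  have "decseq (\<lambda>k. F (\<xi> k))"
  proof (rule decseq_SucI)
    show "F (\<xi> (Suc k)) \<le> F (\<xi> k)" for k
      using decrease[of k] \<open>0 < q\<close> mult_nonneg_nonneg[of q "(norm (gradient F (\<xi> k)))\<^sup>2"]
      unfolding q_def by simp
  qed
  moreover have "F \<xi>bar \<le> F (\<xi> k)" for k
  proof -
    have "F \<xi>bar \<le> F \<xi>bar + 1/2 * (norm (\<xi> k - \<xi>bar))\<^sup>2" by simp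
    also have "\<dots> \<le> F (\<xi> k)"
      using lower_bound[of \<xi>bar "\<xi> k - \<xi>bar"] by (simp add: solution)
    finally show ?thesis .
  qed
  ultimately obtain a where a: "(\<lambda>k. F (\<xi> k)) \<longlonglongrightarrow> a"
    by (metis decseq_convergent)
  have "(\<lambda>k. (F (\<xi> k) - F (\<xi> (Suc k))) / q) \<longlonglongrightarrow> (a - a) / q"
    using \<open>0 < q\<close> by (intro tendsto_intros a LIMSEQ_Suc) auto
  then have lim: "(\<lambda>k. (F (\<xi> k) - F (\<xi> (Suc k))) / q) \<longlonglongrightarrow> 0" by simp
  have "(\<lambda>k. (norm (gradient F (\<xi> k)))\<^sup>2) \<longlonglongrightarrow> 0"
  proof (rule real_tendsto_sandwich[OF _ _ tendsto_const lim])
    show "\<forall>\<^sub>F k in sequentially. (norm (gradient F (\<xi> k)))\<^sup>2 \<le> (F (\<xi> k) - F (\<xi> (Suc k))) / q"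
      using decrease \<open>0 < q\<close> unfolding q_def[symmetric]
      by (intro always_eventually allI) (simp add: pos_le_divide_eq mult.commute le_diff_eq algebra_simps)
  qed simp
  from tendsto_real_sqrt[OF this] show ?thesis by simp
qed

text \<open>Strong monotonicity between the iterate and the solution, then Cauchy-Schwarz.\<close>

lemma error_le_gradient: "norm (\<xi> k - \<xi>bar) \<le> norm (gradient F (\<xi> k))"
proof -
  have "(norm (\<xi> k - \<xi>bar))\<^sup>2 \<le> norm (gradient F (\<xi> k)) * norm (\<xi> k - \<xi>bar)"
    using gradient_strongly_monotone[where x = \<xi>bar and y = "\<xi> k"]
      norm_cauchy_schwarz[of "gradient F (\<xi> k)" "\<xi> k - \<xi>bar"] by (simp add: solution)
  then show ?thesis
    by (cases "\<xi> k = \<xi>bar") (simp_all add: power2_eq_square)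
qed

lemma error_tendsto: "(\<lambda>k. \<xi> k - \<xi>bar) \<longlonglongrightarrow> 0"
  by (rule Lim_null_comparison[OF _ gradient_tendsto]) (simp add: error_le_gradient)

lemma iterates_tendsto: "\<xi> \<longlonglongrightarrow> \<xi>bar"
  using error_tendsto by (simp add: LIM_zero_iff)

section \<open>Local superlinear convergence\<close>

lemma value_approx_run:
  assumes "0 < \<epsilon>"
  shows "\<forall>\<^sub>F k in sequentially.
    \<bar>F (\<xi> k) - F \<xi>bar - 1/2 * (blinfun_apply (M k) (\<xi> k - \<xi>bar) \<bullet> (\<xi> k - \<xi>bar))\<bar>
      \<le> \<epsilon> * (norm (\<xi> k - \<xi>bar))\<^sup>2"
  \<comment> \<open>With increment \<open>\<xi> k - \<xi>bar\<close>, the operator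
    \<open>M k\<close> is one of those at the displaced point, so semismoothness at the fixed point
    \<open>\<xi>bar\<close> applies.\<close>
  using eventually_compose_filterlim[OF value_approx[OF assms, of \<xi>bar] error_tendsto]
  by (rule eventually_mono) (use M_in in \<open>auto simp: solution\<close>)

lemma gradient_approx_run:
  assumes "0 < \<epsilon>"
  shows "\<forall>\<^sub>F k in sequentially.
    norm (gradient F (\<xi> k) - blinfun_apply (M k) (\<xi> k - \<xi>bar)) \<le> \<epsilon> * norm (\<xi> k - \<xi>bar)"
  using eventually_compose_filterlim[OF gradient_approx[OF assms, of \<xi>bar] error_tendsto]
  by (rule eventually_mono) (use M_in in \<open>auto simp: solution\<close>)

text \<open>The tolerance is \<eta> times the gradient norm to the power \<tau>, which tends to 0,
  times the gradient norm, which is at most L + 1 times the error.\<close>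

lemma residual_small:
  assumes "0 < \<epsilon>"
  shows "\<forall>\<^sub>F k in sequentially.
    norm (blinfun_apply (M k) (d k) + gradient F (\<xi> k)) \<le> \<epsilon> * norm (\<xi> k - \<xi>bar)"
proof -
  have "(\<lambda>k. \<eta> * norm (gradient F (\<xi> k)) powr \<tau> * (L + 1)) \<longlonglongrightarrow> \<eta> * 0 * (L + 1)"
    using tau by (intro tendsto_intros tendsto_zero_powrI[OF gradient_tendsto tendsto_const]) auto
  then have "\<forall>\<^sub>F k in sequentially. \<eta> * norm (gradient F (\<xi> k)) powr \<tau> * (L + 1) < \<epsilon>"
    using assms by (intro order_tendstoD) auto
  \<comment> \<open>Accuracy 1 suffices here and is the 1 in \<open>L + 1\<close>.\<close>
  with gradient_approx_run[OF zero_less_one] show ?thesis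
  proof eventually_elim
    case (elim k)
    let ?g = "norm (gradient F (\<xi> k))" and ?e = "\<xi> k - \<xi>bar"
    have "?g \<le> norm (blinfun_apply (M k) ?e) + norm ?e"
      using elim(1) norm_triangle_sub[of "gradient F (\<xi> k)" "blinfun_apply (M k) ?e"] by simp
    also have "norm (blinfun_apply (M k) ?e) \<le> L * norm ?e"
      using norm_blinfun[of "M k" ?e] bounded[OF M_in, of k]
      by (meson mult_right_mono norm_ge_zero order_trans)
    finally have "?g \<le> (L + 1) * norm ?e" by (simp add: algebra_simps)
    then have "\<eta> * ?g powr \<tau> * ?g \<le> \<eta> * ?g powr \<tau> * ((L + 1) * norm ?e)"
      using eta by (intro mult_left_mono) auto
    also have "\<dots> \<le> \<epsilon> * norm ?e"
      using elim(2) mult_right_mono[of "\<eta> * ?g powr \<tau> * (L + 1)" \<epsilon> "norm ?e"]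
      by (simp add: mult.assoc)
    finally show ?case
      using residual[of k] by (simp add: powr_add mult.commute mult.left_commute)
  qed
qed

text \<open>\<open>M k\<close> maps the new error to the CG residual minus the semismoothness
  remainder, both small relative to the old error; coercivity with constant 1 removes
  \<open>M k\<close>.\<close>

lemma full_step_superlinear:
  assumes "0 < \<epsilon>"
  shows "\<forall>\<^sub>F k in sequentially. norm (\<xi> k + d k - \<xi>bar) \<le> \<epsilon> * norm (\<xi> k - \<xi>bar)"
proof -
  have half: "0 < \<epsilon> / 2" using assms by simp
  from gradient_approx_run[OF half] residual_small[OF half] show ?thesis
  proof eventually_elim
    case (elim k)
    define w where "w = \<xi> k + d k - \<xi>bar"
    have "(norm w)\<^sup>2 \<le> norm (blinfun_apply (M k) w) * norm w"
      using coercive[OF M_in, of w k] norm_cauchy_schwarz order_trans by blast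
    then have "norm w \<le> norm (blinfun_apply (M k) w)"
      by (cases "w = 0") (simp_all add: power2_eq_square)
    also have "blinfun_apply (M k) w = (blinfun_apply (M k) (d k) + gradient F (\<xi> k))
        - (gradient F (\<xi> k) - blinfun_apply (M k) (\<xi> k - \<xi>bar))"
      by (simp add: w_def blinfun.bilinear_simps)
    also have "norm \<dots> \<le> \<epsilon> / 2 * norm (\<xi> k - \<xi>bar) + \<epsilon> / 2 * norm (\<xi> k - \<xi>bar)"
      by (intro norm_triangle_le_diff add_mono elim)
    finally show ?case by (simp add: w_def)
  qed
qed

text \<open>To leading order the full step lowers F by a / 2, with a the curvature of the error,
  while Armijo demands \<sigma> a. The gap 1/2 - \<sigma> absorbs the remainders.\<close>

lemma eventually_full_step: "\<forall>\<^sub>F k in sequentially. l k = 0"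
proof -
  \<comment> \<open>The remainders add up to at most
    \<open>4 * (L * (\<epsilon> * E)) + \<epsilon> * E\<close>, whence the denominator; the cap 1
    lets the square of \<epsilon> be bounded by \<epsilon>.\<close>
  define \<epsilon> where "\<epsilon> = min 1 ((1/2 - \<sigma>) / (4 * L + 1))"
  have "0 < \<epsilon>" "\<epsilon> \<le> 1" using sigma L_ge_1 by (simp_all add: \<epsilon>_def)
  have "\<epsilon> \<le> (1/2 - \<sigma>) / (4 * L + 1)" by (simp add: \<epsilon>_def)
  then have \<epsilon>_small: "\<epsilon> * (4 * L + 1) \<le> 1/2 - \<sigma>"
    using L_ge_1 by (simp add: pos_le_divide_eq)
  from value_approx_run[OF \<open>0 < \<epsilon>\<close>] full_step_superlinear[OF \<open>0 < \<epsilon>\<close>]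
  show ?thesis
  proof eventually_elim
    case (elim k)
    define e where "e = \<xi> k - \<xi>bar"
    define w where "w = \<xi> k + d k - \<xi>bar"
    define a where "a = blinfun_apply (M k) e \<bullet> e"
    define E where "E = (norm e)\<^sup>2"
    have "0 \<le> E" by (simp add: E_def)
    have w_le: "norm w \<le> \<epsilon> * norm e" using elim(2) by (simp add: w_def e_def)
    have "(norm w)\<^sup>2 \<le> (\<epsilon> * norm e)\<^sup>2"
      using w_le by (intro power_mono) auto
    also have "\<dots> = \<epsilon> * (\<epsilon> * E)" by (simp add: E_def power_mult_distrib power2_eq_square)
    also have "\<dots> \<le> 1 * (\<epsilon> * E)"
      using \<open>0 < \<epsilon>\<close> \<open>\<epsilon> \<le> 1\<close> \<open>0 \<le> E\<close> by (intro mult_right_mono) auto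
    finally have w2: "(norm w)\<^sup>2 \<le> \<epsilon> * E" by simp
    then have Lw2: "L * (norm w)\<^sup>2 \<le> L * (\<epsilon> * E)"
      using L_ge_1 by (intro mult_left_mono) auto
    have "L * norm w * norm e \<le> L * (\<epsilon> * norm e) * norm e"
      using w_le L_ge_1 by (intro mult_left_mono mult_right_mono) auto
    then have cross: "\<bar>blinfun_apply (M k) w \<bullet> e\<bar> \<le> L * (\<epsilon> * E)"
      using inner_bound[OF M_in, of k w e] by (simp add: E_def power2_eq_square)
    have "d k = w - e" by (simp add: w_def e_def)
    \<comment> \<open>The CG identity makes the slope an exact quadratic form, expanded around the
      old error \<open>e\<close>.\<close>
    then have "- (gradient F (\<xi> k) \<bullet> d k) = blinfun_apply (M k) (w - e) \<bullet> (w - e)"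
      using curvature_eq by metis
    also have "\<dots> = blinfun_apply (M k) w \<bullet> w - 2 * (blinfun_apply (M k) w \<bullet> e) + a"
      using symmetric[OF M_in, of k e w]
      by (simp add: a_def blinfun.bilinear_simps inner_simps inner_commute)
    \<comment> \<open>Two cross terms and one square, each at most
      \<open>L * (\<epsilon> * E)\<close>.\<close>
    also have "\<dots> \<le> a + 3 * (L * (\<epsilon> * E))"
      using cross curvature_le[OF M_in, of k w] Lw2 by linarith
    finally have "\<sigma> * - (gradient F (\<xi> k) \<bullet> d k) \<le> \<sigma> * (a + 3 * (L * (\<epsilon> * E)))"
      using sigma by (intro mult_left_mono) auto
    also have "\<dots> \<le> \<sigma> * a + 3 * (L * (\<epsilon> * E))"
    proof -
      have "\<sigma> * (3 * (L * (\<epsilon> * E))) \<le> 1 * (3 * (L * (\<epsilon> * E)))"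
        using sigma L_ge_1 \<open>0 < \<epsilon>\<close> \<open>0 \<le> E\<close> by (intro mult_right_mono) auto
      then show ?thesis by (simp add: distrib_left)
    qed
    finally have dir: "\<sigma> * - (gradient F (\<xi> k) \<bullet> d k) \<le> \<sigma> * a + 3 * (L * (\<epsilon> * E))" .
    have old: "F \<xi>bar + a / 2 - \<epsilon> * E \<le> F (\<xi> k)"
      using elim(1) by (simp add: a_def e_def E_def abs_le_iff)
    \<comment> \<open>The gradient vanishes at the solution, so only the quadratic term of the upper
      model remains.\<close>
    have new: "F (\<xi> k + d k) \<le> F \<xi>bar + L / 2 * (norm w)\<^sup>2"
      using upper_bound[of \<xi>bar w] by (simp add: solution w_def)
    have "E \<le> a" using coercive[OF M_in] by (simp add: E_def a_def)
    then have "(1/2 - \<sigma>) * E \<le> (1/2 - \<sigma>) * a"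
      using sigma by (intro mult_left_mono) auto
    moreover have "\<epsilon> * (4 * L + 1) * E \<le> (1/2 - \<sigma>) * E"
      using \<epsilon>_small \<open>0 \<le> E\<close> by (rule mult_right_mono)
    ultimately have gain: "4 * (L * (\<epsilon> * E)) + \<epsilon> * E \<le> a / 2 - \<sigma> * a"
      by (simp add: algebra_simps)
    have "0 \<le> L * (\<epsilon> * E)" using L_ge_1 \<open>0 < \<epsilon>\<close> \<open>0 \<le> E\<close> by simp
    then have "F (\<xi> k + d k) - F (\<xi> k) \<le> \<sigma> * (gradient F (\<xi> k) \<bullet> d k)"
      using old new gain dir Lw2 by simp
    then have "armijo F \<sigma> \<beta> (\<xi> k) (d k) 0"
      by (simp add: armijo_def inner_commute)
    then show ?case using not_armijo by blast
  qed
qed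

lemma superlinear:
  "(\<lambda>k. norm (\<xi> (Suc k) - \<xi>bar)) \<in> o(\<lambda>k. norm (\<xi> k - \<xi>bar))"
proof (rule landau_o.smallI)
  fix \<epsilon> :: real assume "0 < \<epsilon>"
  from full_step_superlinear[OF this] eventually_full_step
  show "\<forall>\<^sub>F k in sequentially. norm (norm (\<xi> (Suc k) - \<xi>bar)) \<le> \<epsilon> * norm (norm (\<xi> k - \<xi>bar))"
    by eventually_elim (simp add: xi_Suc)
qed

end

theorem theorem5p13:
  fixes S :: "'u::{real_inner,complete_space} \<Rightarrow>\<^sub>L 'y::{real_inner,complete_space}"
    and z \<xi>bar :: 'y
    and \<alpha> c \<sigma> \<beta> \<eta> \<tau> :: real
    and g :: "'u \<Rightarrow> ereal"
    and D2Psi :: "'y \<Rightarrow> ('y \<Rightarrow>\<^sub>L 'y) set"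
    and \<xi> d :: "nat \<Rightarrow> 'y"
    and M :: "nat \<Rightarrow> 'y \<Rightarrow>\<^sub>L 'y"
    and l :: "nat \<Rightarrow> nat"
  assumes alpha: "\<alpha> > 0"
    and g_proper: "proper_fun g"
    and g_convex: "convex_fun g"
    and g_lsc: "lsc_fun g"
    and g_zero: "g 0 < \<infinity>"
    and D2Psi_psd: "\<And>y. D2Psi y \<subseteq> psd_operators"
    and Psi_semismooth: "second_order_semismooth (Psi S \<alpha> g) D2Psi"
    and c_pos: "c > 0"
    and D2Psi_bounded: "\<And>y N. N \<in> D2Psi y \<Longrightarrow> norm N \<le> c"
    and sigma: "0 < \<sigma>" "\<sigma> < 1/2"
    and beta: "0 < \<beta>" "\<beta> < 1"
    and eta: "\<eta> \<ge> 0"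
    and tau: "0 < \<tau>" "\<tau> \<le> 1"
    and solution: "gradient (Phi S z \<alpha> g) \<xi>bar = 0"
    and run: "newton_run (Phi S z \<alpha> g) (D2Phi D2Psi) \<sigma> \<beta> \<eta> \<tau> \<xi> M d l"
    and genuine_steps: "\<And>k. d k \<noteq> 0"
  shows "\<xi> \<longlonglongrightarrow> \<xi>bar \<and>
         (\<lambda>k. norm (\<xi> (Suc k) - \<xi>bar)) \<in> o(\<lambda>k. norm (\<xi> k - \<xi>bar))"
proof -
  interpret newton_cg_run "Phi S z \<alpha> g" "D2Phi D2Psi" "1 + c" \<sigma> \<beta> \<eta> \<tau> \<xi>bar \<xi> d M l
  proof
    show "second_order_semismooth (Phi S z \<alpha> g) (D2Phi D2Psi)"
      using second_order_semismooth_add_quadratic[OF Psi_semismooth, of z]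
      unfolding Phi_def[abs_def] D2Phi_def[abs_def] .
  next
    fix N y and u v :: 'y
    assume "N \<in> D2Phi D2Psi y"
    then obtain N' where N: "N = id_blinfun + N'" and N': "N' \<in> D2Psi y"
      by (auto simp: D2Phi_def)
    have psd: "N' \<in> psd_operators" using N' D2Psi_psd by blast
    show "blinfun_apply N u \<bullet> v = u \<bullet> blinfun_apply N v"
      using psd_operators_symmetric[OF psd] by (simp add: N blinfun.add_left inner_simps)
    show "(norm v)\<^sup>2 \<le> blinfun_apply N v \<bullet> v"
      using psd
      by (simp add: N blinfun.add_left inner_simps power2_norm_eq_inner psd_operators_def)
    \<comment> \<open>An inequality, as the norm is 0 on a trivial space.\<close>
    have "norm (id_blinfun :: 'y \<Rightarrow>\<^sub>L 'y) \<le> 1"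
      by (rule norm_blinfun_bound) auto
    then show "norm N \<le> 1 + c"
      unfolding N using norm_triangle_ineq D2Psi_bounded[OF N'] by (meson add_mono order_trans)
  qed (use sigma beta eta tau solution run genuine_steps in auto)
  show ?thesis using iterates_tendsto superlinear by blast
qed

end
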